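(* Let $X$ be a set, let $F$ be a set of functions from $X$ to $[0,1]$, and let $\epsilon>0$. If there exists $\alpha>0$ such that $\mathrm{fat}_F(\epsilon+\alpha)$ is infinite, then $F$ is not $\epsilon$-agnostically learnable.
   Context: A learner for $X$ is a mapping from $\bigcup_{n}(X\times[0,1])^n$ to $[0,1]^X$. For $h:X\to[0,1]$ and a probability distribution $P$ on $X\times[0,1]$, $\mathbf{er}_P(h)=\int|h(x)-y|\,dP(x,y)$. A learner $A$ $(\epsilon,\delta)$-learns in the agnostic sense with respect to $F$ from $m$ examples if for all probability distributions $P$ on $X\times[0,1]$, $$P^m\Big\{w\in(X\times[0,1])^m:\ \mathbf{er}_P(A(w))\ge\inf_{f\in F}\mathbf{er}_P(f)+\epsilon\Big\}<\delta .$$ $F$ is $\epsilon$-agnostically learnable if there is a function $m_0:(0,1)\to\mathbb N$ such that for all $0<\delta<1$ there is a learner $A$ which $(\epsilon,\delta)$-learns in the agnostic sense with respect to $F$ from $m_0(\delta)$ examples. $F$ $\gamma$-fatly shatters a sequence $(x_1,r_1),\dots,(x_d,r_d)$ in $X\times[0,1]$ if for every $b\in\{0,1\}^d$ there is $f\in F$ with, for all $j$, $f(x_j)\ge r_j+\gamma$ if $b_j=1$ and $f(x_j)\le r_j-\gamma$ if $b_j=0$. $\mathrm{fat}_F(\gamma)$ is the largest length of such a sequence ($\infty$ if unbounded). Convention: issues of measurability are ignored; the reader may assume that $X$ is countable with all subsets measurable. *)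

theory Defs
  imports "HOL-Probability.Probability"
begin

text \<open>
  Samples and labelled sequences are lists over \<open>X \<times> {0..1}\<close>. Functions \<open>X \<rightarrow> [0,1]\<close> are
  HOL functions mapping \<open>X\<close> into \<open>{0..1}\<close>; nothing below depends on their values outside \<open>X\<close>.
\<close>

text \<open>All subsets of \<open>X\<close> are measurable, and \<open>[0,1]\<close> carries its Borel sets.\<close>

definition example_space :: "'a set \<Rightarrow> ('a \<times> real) measure" where
  "example_space X = count_space X \<Otimes>\<^sub>M restrict_space borel {0..1}"

definition distribution_on :: "'a set \<Rightarrow> ('a \<times> real) measure \<Rightarrow> bool" where
  "distribution_on X P \<longleftrightarrow> prob_space P \<and> sets P = sets (example_space X)"

definition er :: "('a \<times> real) measure \<Rightarrow> ('a \<Rightarrow> real) \<Rightarrow> real" where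
  "er P h = (\<integral>(x, y). \<bar>h x - y\<bar> \<partial>P)"

definition is_learner :: "'a set \<Rightarrow> (('a \<times> real) list \<Rightarrow> 'a \<Rightarrow> real) \<Rightarrow> bool" where
  "is_learner X A \<longleftrightarrow> A \<in> lists (X \<times> {0..1}) \<rightarrow> (X \<rightarrow> {0..1})"

text \<open>
  Learners are not assumed measurable, so the failure event need not lie in the product
  sigma-algebra. Its probability is therefore taken as the outer probability, which agrees with
  the usual one on measurable events (\<open>outer_measure_of_eq\<close>); using \<open>measure\<close> directly would
  assign probability \<open>0\<close> to every non-measurable failure event. The infimum is only meaningful for
  nonempty \<open>F\<close>; the errors are nonnegative, so it then exists.
\<close>

definition agnostically_learns ::
  "'a set \<Rightarrow> ('a \<Rightarrow> real) set \<Rightarrow> real \<Rightarrow> real \<Rightarrow> nat \<Rightarrow> (('a \<times> real) list \<Rightarrow> 'a \<Rightarrow> real) \<Rightarrow> bool"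
where
  "agnostically_learns X F \<epsilon> \<delta> m A \<longleftrightarrow>
    (\<forall>P. distribution_on X P \<longrightarrow>
      outer_measure_of (Pi\<^sub>M {..<m} (\<lambda>_. P))
        {w \<in> space (Pi\<^sub>M {..<m} (\<lambda>_. P)).
          er P (A (map w [0..<m])) \<ge> (INF f\<in>F. er P f) + \<epsilon>} < ennreal \<delta>)"

definition agnostically_learnable :: "'a set \<Rightarrow> ('a \<Rightarrow> real) set \<Rightarrow> real \<Rightarrow> bool" where
  "agnostically_learnable X F \<epsilon> \<longleftrightarrow>
    (\<exists>m\<^sub>0 :: real \<Rightarrow> nat. \<forall>\<delta>. 0 < \<delta> \<and> \<delta> < 1 \<longrightarrow>
      (\<exists>A. is_learner X A \<and> agnostically_learns X F \<epsilon> \<delta> (m\<^sub>0 \<delta>) A))"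

definition fat_shatters :: "('a \<Rightarrow> real) set \<Rightarrow> real \<Rightarrow> ('a \<times> real) list \<Rightarrow> bool" where
  "fat_shatters F \<gamma> s \<longleftrightarrow>
    (\<forall>b :: bool list. length b = length s \<longrightarrow>
      (\<exists>f\<in>F. \<forall>j<length s.
        (b ! j \<longrightarrow> f (fst (s ! j)) \<ge> snd (s ! j) + \<gamma>) \<and>
        (\<not> b ! j \<longrightarrow> f (fst (s ! j)) \<le> snd (s ! j) - \<gamma>)))"

definition fat :: "'a set \<Rightarrow> ('a \<Rightarrow> real) set \<Rightarrow> real \<Rightarrow> enat" where
  "fat X F \<gamma> = (SUP s\<in>{s \<in> lists (X \<times> {0..1}). fat_shatters F \<gamma> s}. enat (length s))"

end

theory Submission
  imports Defs
begin

text \<open>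
  Let \<open>\<gamma> = \<epsilon> + \<alpha>\<close>. On a fatly shattered sequence \<open>(x\<^sub>1,r\<^sub>1), \<dots>, (x\<^sub>d,r\<^sub>d)\<close>, choose \<open>S \<subseteq> {1,\<dots>,d}\<close>
  uniformly at random and let \<open>P\<^sub>S\<close> be uniform on the points \<open>(x\<^sub>j, 1[j \<in> S])\<close>; the labels are the
  extreme values 0 and 1, not values near \<open>r\<^sub>j\<close>. Averaged over \<open>S\<close>, every learner has error
  exactly \<open>1/2\<close> at a point it has not seen, whereas the witness \<open>f\<^sub>S\<close> has error at most
  \<open>((1 - r\<^sub>j - \<gamma>) + (r\<^sub>j - \<gamma>)) / 2 = 1/2 - \<gamma>\<close> at each point. So the mean regret is at least
  \<open>\<gamma> - m/(2d)\<close>, which exceeds \<open>\<epsilon> + \<alpha>/2\<close> for large \<open>d\<close>; as the regret is at most 1, for some \<open>S\<close> it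
  reaches \<open>\<epsilon>\<close> with probability at least \<open>\<alpha>/2\<close>.
\<close>

section \<open>Averaging over subsets\<close>

definition toggle :: "'i \<Rightarrow> 'i set \<Rightarrow> 'i set" where
  "toggle j S = (if j \<in> S then S - {j} else insert j S)"

lemma mem_toggle: "i \<in> toggle j S \<longleftrightarrow> (if i = j then i \<notin> S else i \<in> S)"
  by (auto simp: toggle_def)

lemma toggle_toggle [simp]: "toggle j (toggle j S) = S"
  by (auto simp: toggle_def)

text \<open>Toggling \<open>j\<close> is an involution of \<open>Pow I\<close> that flips only the
  label at \<open>j\<close>. A sum over all labellings can thus be estimated pair by pair, each pair
  containing both labels of \<open>j\<close>.\<close>

lemma sum_Pow_toggle:
  fixes g :: "'i set \<Rightarrow> real"
  assumes "j \<in> I"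
  shows "(\<Sum>S\<in>Pow I. g S) = (\<Sum>S\<in>Pow I. (g S + g (toggle j S)) / 2)"
proof -
  have "(\<Sum>S\<in>Pow I. g S) = (\<Sum>S\<in>Pow I. g (toggle j S))"
    by (rule sum.reindex_bij_witness[of _ "toggle j" "toggle j"])
      (use assms in \<open>auto simp: mem_toggle split: if_splits\<close>)
  then show ?thesis
    by (simp add: sum.distrib flip: sum_divide_distrib)
qed

section \<open>Uniform distributions on finitely many examples\<close>

text \<open>A push-forward from the index set: errors become averages over indices, with repeated
  points counted by multiplicity.\<close>

definition empirical :: "'a set \<Rightarrow> 'i set \<Rightarrow> ('i \<Rightarrow> 'a \<times> real) \<Rightarrow> ('a \<times> real) measure" where
  "empirical X I z = distr (uniform_count_measure I) (example_space X) z"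

lemma space_example_space: "space (example_space X) = X \<times> {0..1}"
  by (simp add: example_space_def space_pair_measure)

lemma singleton_in_example_space:
  assumes "p \<in> X \<times> {0..1}"
  shows "{p} \<in> sets (example_space X)"
proof -
  have "{fst p} \<times> {snd p} \<in> sets (example_space X)"
    unfolding example_space_def
    by (rule pair_measureI) (use assms in \<open>auto simp: sets_restrict_space_iff\<close>)
  moreover have "{fst p} \<times> {snd p} = {p}"
    by auto
  ultimately show ?thesis
    by simp
qed

lemma measurable_uniform_count_measure:
  "z \<in> I \<rightarrow> X \<times> {0..1} \<Longrightarrow> z \<in> uniform_count_measure I \<rightarrow>\<^sub>M example_space X"
  by (auto simp: measurable_def space_example_space space_uniform_count_measure
      sets_uniform_count_measure)

lemma sets_empirical [simp]: "sets (empirical X I z) = sets (example_space X)"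
  by (simp add: empirical_def)

lemma space_empirical [simp]: "space (empirical X I z) = X \<times> {0..1}"
  by (simp add: empirical_def space_example_space)

lemma distribution_on_empirical:
  assumes "finite I" "I \<noteq> {}" "z \<in> I \<rightarrow> X \<times> {0..1}"
  shows "distribution_on X (empirical X I z)"
proof -
  interpret prob_space "uniform_count_measure I"
    using assms by (intro prob_space_uniform_count_measure)
  show ?thesis
    using measurable_uniform_count_measure[OF assms(3)]
    by (simp add: distribution_on_def empirical_def prob_space_distr)
qed

lemma er_empirical:
  assumes "finite I" "z \<in> I \<rightarrow> X \<times> {0..1}"
  shows "er (empirical X I z) h = (\<Sum>j\<in>I. \<bar>h (fst (z j)) - snd (z j)\<bar>) / card I"
proof -
  \<comment> \<open>All subsets of \<open>X\<close> are measurable, so any \<open>h\<close> is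
    admissible, in particular the output of an arbitrary learner.\<close>
  have "(\<lambda>p. h (fst p)) \<in> borel_measurable (example_space X)"
    unfolding example_space_def
    by (rule measurable_compose[OF measurable_fst]) simp
  moreover have "snd \<in> borel_measurable (example_space X)"
    unfolding example_space_def
    by (rule measurable_compose[OF measurable_snd, where g = "\<lambda>y. y", simplified])
      (simp add: measurable_restrict_space1)
  ultimately have "(\<lambda>(x, y). \<bar>h x - y\<bar>) \<in> borel_measurable (example_space X)"
    by (simp add: case_prod_beta)
  then show ?thesis
    unfolding er_def empirical_def
    using assms measurable_uniform_count_measure[OF assms(2)]
    by (simp add: integral_distr integral_uniform_count_measure case_prod_beta)
qed

lemma emeasure_empirical_singleton:
  assumes "finite I" "z \<in> I \<rightarrow> X \<times> {0..1}" "inj_on z I" "j \<in> I"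
  shows "emeasure (empirical X I z) {z j} = ennreal (1 / card I)"
proof -
  have "z -` {z j} \<inter> I = {j}"
    using assms by (auto simp: inj_on_def)
  moreover have "{z j} \<in> sets (example_space X)"
    using assms by (intro singleton_in_example_space) auto
  ultimately show ?thesis
    unfolding empirical_def
    using assms measurable_uniform_count_measure[OF assms(2)]
    by (simp add: emeasure_distr space_uniform_count_measure emeasure_uniform_count_measure)
qed

text \<open>A finite set of measurable atoms is measurable even if \<open>B\<close> is not, so its
  ordinary measure bounds the outer measure of \<open>B\<close> from below by monotonicity.\<close>

lemma outer_measure_of_ge_finite:
  assumes "finite T" "T \<subseteq> B"
    and "\<And>t. t \<in> T \<Longrightarrow> {t} \<in> sets M" "\<And>t. t \<in> T \<Longrightarrow> emeasure M {t} = c"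
  shows "outer_measure_of M B \<ge> of_nat (card T) * c"
proof -
  have "T \<in> sets M"
    using assms(1,3) by (metis sets.countable countable_finite)
  have "of_nat (card T) * c = emeasure M T"
    using assms by (simp add: emeasure_eq_sum_singleton)
  also have "\<dots> = outer_measure_of M T"
    using \<open>T \<in> sets M\<close> by (simp add: outer_measure_of_eq)
  also have "\<dots> \<le> outer_measure_of M B"
    using assms(2) by (rule outer_measure_of_mono)
  finally show ?thesis .
qed

text \<open>Reduces probabilities of samples to counting index vectors: as \<open>z\<close> is
  injective, distinct \<open>J\<close> give distinct samples, all of the same mass.\<close>

lemma outer_measure_PiM_empirical_ge:
  fixes z :: "'i \<Rightarrow> 'a \<times> real" and K :: "'k set"
  assumes "finite I" "I \<noteq> {}" "finite K" "z \<in> I \<rightarrow> X \<times> {0..1}" "inj_on z I"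
    and "T \<subseteq> K \<rightarrow>\<^sub>E I" and "(\<lambda>J. \<lambda>i\<in>K. z (J i)) ` T \<subseteq> B"
  shows "outer_measure_of (Pi\<^sub>M K (\<lambda>_. empirical X I z)) B
    \<ge> ennreal (card T / card (K \<rightarrow>\<^sub>E I))"
proof -
  let ?P = "empirical X I z" and ?w = "\<lambda>J. \<lambda>i\<in>K. z (J i)"
  interpret prob_space ?P
    using distribution_on_empirical assms by (auto simp: distribution_on_def)
  interpret product_sigma_finite "\<lambda>_::'k. ?P"
    by standard
  have "finite T"
    using assms by (metis finite_PiE finite_subset)
  have inj: "inj_on ?w T"
  proof (rule inj_onI)
    fix J J' assume J: "J \<in> T" "J' \<in> T" "?w J = ?w J'"
    have JE: "J \<in> K \<rightarrow>\<^sub>E I" "J' \<in> K \<rightarrow>\<^sub>E I"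
      using J assms(6) by auto
    show "J = J'"
    proof (rule PiE_ext[OF JE])
      fix i assume i: "i \<in> K"
      then have "z (J i) = z (J' i)"
        using fun_cong[OF J(3), of i] by simp
      then show "J i = J' i"
        using inj_onD[OF assms(5)] PiE_mem[OF JE(1) i] PiE_mem[OF JE(2) i] by blast
    qed
  qed
  \<comment> \<open>A single sample is a box of singletons, so the product measure evaluates it as a
    product of point masses.\<close>
  have box: "{?w J} = (\<Pi>\<^sub>E i\<in>K. {z (J i)})" for J
    by (intro set_eqI) (auto simp: PiE_iff extensional_def fun_eq_iff)
  have sets: "{?w J} \<in> sets (Pi\<^sub>M K (\<lambda>_. ?P))" if "J \<in> T" for J
    unfolding box
    by (rule sets_PiM_I_finite)
      (use assms that in \<open>auto intro!: singleton_in_example_space simp: PiE_iff Pi_iff\<close>)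
  have meas: "emeasure (Pi\<^sub>M K (\<lambda>_. ?P)) {?w J} = ennreal (1 / card (K \<rightarrow>\<^sub>E I))"
    if "J \<in> T" for J
  proof -
    have mem: "J i \<in> I" if "i \<in> K" for i
      using that \<open>J \<in> T\<close> assms(6) by auto
    have "emeasure (Pi\<^sub>M K (\<lambda>_. ?P)) {?w J} = (\<Prod>i\<in>K. emeasure ?P {z (J i)})"
      unfolding box using assms mem
      by (intro emeasure_PiM) (auto simp only: sets_empirical Pi_iff intro!: singleton_in_example_space)
    also have "\<dots> = (\<Prod>i\<in>K. ennreal (1 / card I))"
      using assms mem by (intro prod.cong) (auto simp: emeasure_empirical_singleton)
    also have "\<dots> = ennreal (1 / card (K \<rightarrow>\<^sub>E I))"
      using assms by (simp add: ennreal_power card_PiE power_divide)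
    finally show ?thesis .
  qed
  have "of_nat (card (?w ` T)) * ennreal (1 / card (K \<rightarrow>\<^sub>E I))
    \<le> outer_measure_of (Pi\<^sub>M K (\<lambda>_. ?P)) B"
    by (rule outer_measure_of_ge_finite) (use \<open>finite T\<close> assms(7) sets meas in auto)
  then show ?thesis
    using inj by (simp add: card_image ennreal_of_nat_eq_real_of_nat flip: ennreal_mult)
qed

section \<open>Fat shattering\<close>

lemma fat_infinite_long:
  assumes "fat X F \<gamma> = \<infinity>"
  obtains s where "s \<in> lists (X \<times> {0..1})" "fat_shatters F \<gamma> s" "length s > n"
proof -
  have "enat n < fat X F \<gamma>"
    using assms by simp
  then show ?thesis
    unfolding fat_def less_SUP_iff using that by auto
qed

lemma fat_shatters_set:
  assumes "fat_shatters F \<gamma> s"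
  obtains f where "f \<in> F"
    "\<And>j. j < length s \<Longrightarrow> j \<in> S \<Longrightarrow> f (fst (s ! j)) \<ge> snd (s ! j) + \<gamma>"
    "\<And>j. j < length s \<Longrightarrow> j \<notin> S \<Longrightarrow> f (fst (s ! j)) \<le> snd (s ! j) - \<gamma>"
proof -
  let ?b = "map (\<lambda>j. j \<in> S) [0..<length s]"
  have "length ?b = length s"
    by simp
  then obtain f where "f \<in> F"
    "\<forall>j<length s. (?b ! j \<longrightarrow> f (fst (s ! j)) \<ge> snd (s ! j) + \<gamma>) \<and>
        (\<not> ?b ! j \<longrightarrow> f (fst (s ! j)) \<le> snd (s ! j) - \<gamma>)"
    using assms unfolding fat_shatters_def by blast
  then show ?thesis
    using that by auto
qed

text \<open>If positions \<open>i\<close> and \<open>j\<close> shared a point, the two patterns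
  separating them would give r_i + \<gamma> \<le> r_j - \<gamma> and the same with i and j
  exchanged, which is impossible for \<gamma> > 0.\<close>

lemma fat_shatters_inj:
  assumes "fat_shatters F \<gamma> s" "\<gamma> > 0"
  shows "inj_on (\<lambda>j. fst (s ! j)) {..<length s}"
proof (rule inj_onI, rule ccontr)
  fix i j assume ij: "i \<in> {..<length s}" "j \<in> {..<length s}" "fst (s ! i) = fst (s ! j)" "i \<noteq> j"
  obtain f where "f (fst (s ! i)) \<ge> snd (s ! i) + \<gamma>" "f (fst (s ! j)) \<le> snd (s ! j) - \<gamma>"
    using fat_shatters_set[OF assms(1), of "{i}"] ij by (metis lessThan_iff singletonD singletonI)
  moreover obtain g where "g (fst (s ! j)) \<ge> snd (s ! j) + \<gamma>" "g (fst (s ! i)) \<le> snd (s ! i) - \<gamma>"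
    using fat_shatters_set[OF assms(1), of "{j}"] ij by (metis lessThan_iff singletonD singletonI)
  ultimately show False
    using assms(2) ij(3) by simp
qed

section \<open>The lower bound\<close>

text \<open>A reverse Markov inequality: pointwise, \<open>a J\<close> is at most \<epsilon> plus
  the indicator of \<open>a J \<ge> \<epsilon>\<close>, because \<open>a J \<le> 1\<close> and
  \<epsilon> \<ge> 0.\<close>

lemma card_ge_if_sum_ge:
  fixes a :: "'i \<Rightarrow> real" and \<epsilon> \<delta> :: real
  assumes "finite \<Omega>" "\<And>J. J \<in> \<Omega> \<Longrightarrow> a J \<le> 1" "\<epsilon> \<ge> 0"
    and "(\<Sum>J\<in>\<Omega>. a J) \<ge> card \<Omega> * (\<epsilon> + \<delta>)"
  shows "card {J \<in> \<Omega>. a J \<ge> \<epsilon>} \<ge> card \<Omega> * \<delta>"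
proof -
  have "(\<Sum>J\<in>\<Omega>. a J) \<le> (\<Sum>J\<in>\<Omega>. \<epsilon> + (if a J \<ge> \<epsilon> then 1 else 0))"
    using assms by (intro sum_mono) (auto simp: add_increasing)
  also have "\<dots> = card \<Omega> * \<epsilon> + card {J \<in> \<Omega>. a J \<ge> \<epsilon>}"
    using assms(1) by (simp add: sum.distrib sum.If_cases Int_def)
  finally show ?thesis
    using assms(4) by (simp add: algebra_simps)
qed

text \<open>With \<open>J\<close> fixed, changing the label of an index outside its range leaves the
  sample unchanged. The learner then predicts the same v in [0,1] for both labels, with losses v and
  1 - v. At least d - m indices are unseen; the losses at the others are only used as
  nonnegative.\<close>

lemma learner_error_ge:
  fixes A :: "('a \<times> real) list \<Rightarrow> 'a \<Rightarrow> real" and x :: "nat \<Rightarrow> 'a"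
  assumes "is_learner X A" "x \<in> {..<d} \<rightarrow> X" "J \<in> {..<m} \<rightarrow> {..<d}"
  defines "z \<equiv> \<lambda>S j. (x j, indicat_real S j)"
  shows "(\<Sum>S\<in>Pow {..<d}. \<Sum>j<d. \<bar>A (map (\<lambda>i. z S (J i)) [0..<m]) (x j) - indicat_real S j\<bar>)
    \<ge> 2 ^ d * (real d - real m) / 2"
proof -
  let ?w = "\<lambda>S. map (\<lambda>i. z S (J i)) [0..<m]"
  let ?L = "\<lambda>S j. \<bar>A (?w S) (x j) - indicat_real S j\<bar>"
  let ?V = "J ` {..<m}"
  have unseen: "(\<Sum>S\<in>Pow {..<d}. ?L S j) = 2 ^ d / 2" if j: "j \<in> {..<d} - ?V" for j
  proof -
    have "?L S j + ?L (toggle j S) j = 1" for S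
    proof -
      have "?w (toggle j S) = ?w S"
        using j by (auto simp: z_def indicator_def mem_toggle)
      moreover have "?w S \<in> lists (X \<times> {0..1})"
        using assms(2,3) by (auto simp: z_def indicator_def Pi_iff)
      then have "A (?w S) (x j) \<in> {0..1}"
        using assms(1,2) j by (auto simp: is_learner_def Pi_iff)
      ultimately show ?thesis
        by (simp add: indicator_def mem_toggle del: map_eq_conv)
    qed
    then show ?thesis
      using j by (subst sum_Pow_toggle[of j]) (auto simp: card_Pow)
  qed
  have "card ?V \<le> m"
    using card_image_le[of "{..<m}" J] by simp
  then have "real d - real m \<le> card ({..<d} - ?V)"
    using diff_card_le_card_Diff[of ?V "{..<d}"] by simp
  then have "2 ^ d * (real d - real m) / 2 \<le> (\<Sum>j\<in>{..<d} - ?V. \<Sum>S\<in>Pow {..<d}. ?L S j)"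
    by (simp add: unseen)
  also have "\<dots> \<le> (\<Sum>j<d. \<Sum>S\<in>Pow {..<d}. ?L S j)"
    by (intro sum_mono2) (auto intro: sum_nonneg)
  also have "\<dots> = (\<Sum>S\<in>Pow {..<d}. \<Sum>j<d. ?L S j)"
    by (rule sum.swap)
  finally show ?thesis .
qed

text \<open>Since the labels are 0 and 1 and the values lie in [0,1], each absolute value has a
  known sign: the loss is 1 - f or f. Averaging the two labels of an index cancels
  \<open>r j\<close>.\<close>

lemma witness_error_le:
  fixes f :: "nat set \<Rightarrow> 'a \<Rightarrow> real"
  assumes "\<And>S j. j < d \<Longrightarrow> f S (x j) \<in> {0..1}"
    and "\<And>S j. j < d \<Longrightarrow> j \<in> S \<Longrightarrow> f S (x j) \<ge> r j + \<gamma>"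
    and "\<And>S j. j < d \<Longrightarrow> j \<notin> S \<Longrightarrow> f S (x j) \<le> r j - \<gamma>"
  shows "(\<Sum>S\<in>Pow {..<d}. \<Sum>j<d. \<bar>f S (x j) - indicat_real S j\<bar>) \<le> 2 ^ d * d * (1/2 - \<gamma>)"
proof -
  let ?L = "\<lambda>S j. \<bar>f S (x j) - indicat_real S j\<bar>"
  have "(\<Sum>S\<in>Pow {..<d}. \<Sum>j<d. ?L S j) = (\<Sum>j<d. \<Sum>S\<in>Pow {..<d}. ?L S j)"
    by (rule sum.swap)
  also have "\<dots> \<le> (\<Sum>j<d. 2 ^ d * (1/2 - \<gamma>))"
  proof (rule sum_mono)
    fix j assume "j \<in> {..<d}"
    then have j: "j < d" by simp
    have L: "?L S j \<le> (if j \<in> S then 1 - r j - \<gamma> else r j - \<gamma>)" for S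
      using assms(1)[OF j, of S] assms(2)[OF j, of S] assms(3)[OF j, of S]
      by (auto simp: indicator_def)
    have "(?L S j + ?L (toggle j S) j) / 2 \<le> 1/2 - \<gamma>" for S
      using L[of S] L[of "toggle j S"] by (cases "j \<in> S") (simp_all add: mem_toggle)
    then have "(\<Sum>S\<in>Pow {..<d}. (?L S j + ?L (toggle j S) j) / 2) \<le> (\<Sum>S\<in>Pow {..<d}. 1/2 - \<gamma>)"
      by (rule sum_mono)
    then show "(\<Sum>S\<in>Pow {..<d}. ?L S j) \<le> 2 ^ d * (1/2 - \<gamma>)"
      using j by (subst sum_Pow_toggle[of j]) (auto simp: card_Pow)
  qed
  finally show ?thesis
    by (simp add: mult_ac)
qed

text \<open>The total regret over all pairs of a labelling \<open>S\<close> and an index vector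
  \<open>J\<close> is bounded in two ways: from above for each \<open>S\<close>, by the learning
  assumption, and from below for each \<open>J\<close>, by the two preceding estimates.\<close>

lemma fat_shatters_not_learns:
  fixes X :: "'a set" and F :: "('a \<Rightarrow> real) set" and A :: "('a \<times> real) list \<Rightarrow> 'a \<Rightarrow> real"
  assumes F: "F \<subseteq> X \<rightarrow> {0..1}" and "\<epsilon> \<ge> 0" "\<gamma> > 0"
    and s: "s \<in> lists (X \<times> {0..1})" "fat_shatters F \<gamma> s" "s \<noteq> []"
    and A: "is_learner X A"
    and \<delta>: "\<epsilon> + \<delta> \<le> \<gamma> - real m / (2 * length s)"
  shows "\<not> agnostically_learns X F \<epsilon> \<delta> m A"
proof
  assume learns: "agnostically_learns X F \<epsilon> \<delta> m A"
  define d where "d = length s"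
  define I where "I = {..<d}"
  define x where "x j = fst (s ! j)" for j
  define z where "z S j = (x j, indicat_real S j)" for S j
  define P where "P S = empirical X I (z S)" for S
  \<comment> \<open>Sampling from \<open>P S\<close> amounts to drawing \<open>J\<close> uniformly
    from this set, which does not depend on \<open>S\<close>; hence the two sums can be
    exchanged.\<close>
  define \<Omega> where "\<Omega> = {..<m} \<rightarrow>\<^sub>E I"
  define w where "w S J = map (\<lambda>i. z S (J i)) [0..<m]" for S J
  have "d > 0" and I: "finite I" "I \<noteq> {}" "card I = d"
    using s(3) by (auto simp: d_def I_def)
  have fin: "finite \<Omega>"
    unfolding \<Omega>_def using I by (intro finite_PiE) auto
  have card: "card \<Omega> > 0"
    using I by (simp add: \<Omega>_def card_PiE \<open>d > 0\<close>)
  have x: "x \<in> I \<rightarrow> X"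
  proof
    fix j assume "j \<in> I"
    then have "s ! j \<in> X \<times> {0..1}"
      using s(1) by (auto simp: I_def d_def in_lists_conv_set)
    then show "x j \<in> X"
      by (auto simp: x_def)
  qed
  then have z: "z S \<in> I \<rightarrow> X \<times> {0..1}" for S
    by (auto simp: z_def indicator_def)
  have inj: "inj_on (z S) I" for S
    using fat_shatters_inj[OF s(2) \<open>\<gamma> > 0\<close>] by (auto simp: inj_on_def z_def x_def I_def d_def)
  have er: "er (P S) h = (\<Sum>j<d. \<bar>h (x j) - indicat_real S j\<bar>) / d" for S h
    unfolding P_def using er_empirical[OF I(1) z] I(3) by (simp add: z_def I_def)
  have er_nonneg: "er (P S) h \<ge> 0" for S h
    unfolding er by (intro divide_nonneg_nonneg sum_nonneg) auto
  have "\<exists>f\<in>F. (\<forall>j<d. j \<in> S \<longrightarrow> f (x j) \<ge> snd (s ! j) + \<gamma>) \<and>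
      (\<forall>j<d. j \<notin> S \<longrightarrow> f (x j) \<le> snd (s ! j) - \<gamma>)" for S
    using fat_shatters_set[OF s(2), of S] unfolding d_def x_def by metis
  then obtain f where f: "\<And>S. f S \<in> F"
    "\<And>S j. j < d \<Longrightarrow> j \<in> S \<Longrightarrow> f S (x j) \<ge> snd (s ! j) + \<gamma>"
    "\<And>S j. j < d \<Longrightarrow> j \<notin> S \<Longrightarrow> f S (x j) \<le> snd (s ! j) - \<gamma>"
    by metis
  have f01: "f S (x j) \<in> {0..1}" if "j < d" for S j
    using F f(1)[of S] x that by (auto simp: I_def Pi_iff)
  have w: "w S J \<in> lists (X \<times> {0..1})" if "J \<in> \<Omega>" for S J
  proof -
    have "z S (J i) \<in> X \<times> {0..1}" if "i < m" for i
      using z[of S] that \<open>J \<in> \<Omega>\<close> by (auto simp only: \<Omega>_def PiE_iff Pi_iff lessThan_iff)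
    then show ?thesis
      by (fastforce simp: w_def in_lists_conv_set simp del: mem_Times_iff)
  qed
  \<comment> \<open>Regret is measured against \<open>f S\<close> instead of the infimum. The
    infimum is no larger than the error of \<open>f S\<close>, so regret at least \<epsilon> still
    implies failure.\<close>
  define a where "a S J = er (P S) (A (w S J)) - er (P S) (f S)" for S J
  have a_le: "a S J \<le> 1" if "J \<in> \<Omega>" for S J
  proof -
    have "\<bar>A (w S J) (x j) - indicat_real S j\<bar> \<le> 1" if "j < d" for j
    proof -
      have "A (w S J) (x j) \<in> {0..1}"
        using A w[OF \<open>J \<in> \<Omega>\<close>, of S] x that by (auto simp: is_learner_def Pi_iff I_def)
      then show ?thesis
        by (auto simp: indicator_def)
    qed
    then have "(\<Sum>j<d. \<bar>A (w S J) (x j) - indicat_real S j\<bar>) \<le> (\<Sum>j<d. 1)"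
      by (intro sum_mono) auto
    then have "er (P S) (A (w S J)) \<le> 1"
      using \<open>d > 0\<close> by (simp add: er divide_le_eq)
    then show ?thesis
      using er_nonneg[of S "f S"] by (simp add: a_def)
  qed
  \<comment> \<open>Otherwise reverse Markov puts at least a fraction \<delta> of the index vectors
    into the failure event, whose outer probability is assumed to be strictly below
    \<delta>.\<close>
  have "card \<Omega> * (\<epsilon> + \<delta>) > (\<Sum>J\<in>\<Omega>. a S J)" for S
  proof (rule ccontr)
    assume "\<not> ?thesis"
    then have "card {J \<in> \<Omega>. a S J \<ge> \<epsilon>} \<ge> card \<Omega> * \<delta>"
      using fin a_le \<open>\<epsilon> \<ge> 0\<close> by (intro card_ge_if_sum_ge) auto
    then have "ennreal \<delta> \<le> ennreal (card {J \<in> \<Omega>. a S J \<ge> \<epsilon>} / card \<Omega>)"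
      using card by (intro ennreal_leI) (simp add: field_simps)
    also have "\<dots> \<le> outer_measure_of (Pi\<^sub>M {..<m} (\<lambda>_. P S))
        {w \<in> space (Pi\<^sub>M {..<m} (\<lambda>_. P S)).
          er (P S) (A (map w [0..<m])) \<ge> (INF f\<in>F. er (P S) f) + \<epsilon>}"
      unfolding P_def \<Omega>_def
    proof (rule outer_measure_PiM_empirical_ge[OF I(1,2) _ z inj], goal_cases)
      case 3
      have "(INF f\<in>F. er (P S) f) \<le> er (P S) (f S)"
        using er_nonneg by (intro cINF_lower bdd_belowI2[where m = 0] f(1))
      moreover have "map (\<lambda>i\<in>{..<m}. z S (J i)) [0..<m] = w S J" for J
        by (auto simp: w_def)
      moreover have "(\<lambda>i\<in>{..<m}. z S (J i)) \<in> space (Pi\<^sub>M {..<m} (\<lambda>_. P S))"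
        if "J \<in> {..<m} \<rightarrow>\<^sub>E I" for J
        using z[of S] that by (auto simp only: P_def space_PiM space_empirical PiE_iff Pi_iff
            restrict_extensional restrict_apply lessThan_iff if_True)
      ultimately show ?case
        unfolding P_def[symmetric] a_def by fastforce
    qed auto
    finally show False
      using learns distribution_on_empirical[OF I(1,2) z, of S]
      unfolding agnostically_learns_def P_def by (auto simp: not_less[symmetric])
  qed
  then have "(\<Sum>S\<in>Pow I. \<Sum>J\<in>\<Omega>. a S J) < (\<Sum>S\<in>Pow I. card \<Omega> * (\<epsilon> + \<delta>))"
    using I by (intro sum_strict_mono) auto
  also have "\<dots> = card \<Omega> * 2 ^ d * (\<epsilon> + \<delta>)"
    using I by (simp add: card_Pow)
  also have "\<dots> \<le> card \<Omega> * 2 ^ d * (\<gamma> - real m / (2 * d))"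
    using \<delta> by (intro mult_left_mono) (auto simp: d_def)
  also have "\<dots> = (\<Sum>J\<in>\<Omega>. 2 ^ d * (\<gamma> - real m / (2 * d)))"
    by simp
  also have "\<dots> \<le> (\<Sum>J\<in>\<Omega>. \<Sum>S\<in>Pow I. a S J)"
  proof (rule sum_mono)
    fix J assume "J \<in> \<Omega>"
    then have J: "J \<in> {..<m} \<rightarrow> {..<d}"
      by (auto simp: \<Omega>_def I_def)
    \<comment> \<open>The left side simplifies to 2^d (\<gamma> - m/(2d)); dividing by
      \<open>d\<close> turns the summed losses into values of \<open>er\<close>.\<close>
    have "(2 ^ d * (real d - real m) / 2 - 2 ^ d * d * (1/2 - \<gamma>)) / d \<le>
      ((\<Sum>S\<in>Pow {..<d}. \<Sum>j<d. \<bar>A (w S J) (x j) - indicat_real S j\<bar>) -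
       (\<Sum>S\<in>Pow {..<d}. \<Sum>j<d. \<bar>f S (x j) - indicat_real S j\<bar>)) / d"
      using learner_error_ge[OF A x[unfolded I_def] J]
        witness_error_le[of d f x "\<lambda>j. snd (s ! j)" \<gamma>, OF f01 f(2,3)]
      unfolding w_def z_def by (intro divide_right_mono diff_mono) auto
    also have "\<dots> = (\<Sum>S\<in>Pow I. a S J)"
      by (simp add: a_def er I_def sum_subtractf diff_divide_distrib sum_divide_distrib)
    finally show "2 ^ d * (\<gamma> - real m / (2 * d)) \<le> (\<Sum>S\<in>Pow I. a S J)"
      using \<open>d > 0\<close> by (simp add: field_simps)
  qed
  also have "\<dots> = (\<Sum>S\<in>Pow I. \<Sum>J\<in>\<Omega>. a S J)"
    by (rule sum.swap)
  finally show False
    by simp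
qed

theorem theorem26:
  fixes X :: "'a set" and F :: "('a \<Rightarrow> real) set" and \<epsilon> :: real
  assumes "F \<subseteq> X \<rightarrow> {0..1}"
    and "\<epsilon> > 0"
    and "\<exists>\<alpha>>0. fat X F (\<epsilon> + \<alpha>) = \<infinity>"
  shows "\<not> agnostically_learnable X F \<epsilon>"
proof
  assume "agnostically_learnable X F \<epsilon>"
  then obtain m\<^sub>0 where m\<^sub>0: "\<And>\<delta>. 0 < \<delta> \<Longrightarrow> \<delta> < 1 \<Longrightarrow>
      \<exists>A. is_learner X A \<and> agnostically_learns X F \<epsilon> \<delta> (m\<^sub>0 \<delta>) A"
    unfolding agnostically_learnable_def by blast
  obtain \<alpha> where \<alpha>: "\<alpha> > 0" "fat X F (\<epsilon> + \<alpha>) = \<infinity>"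
    using assms(3) by blast
  \<comment> \<open>Half of the slack \<alpha> is spent on the failure probability and the other
    half will absorb m/(2d). The cap 1/2 keeps \<delta> below 1.\<close>
  define \<delta> where "\<delta> = min (\<alpha> / 2) (1 / 2)"
  have \<delta>: "0 < \<delta>" "\<delta> < 1" "\<delta> \<le> \<alpha> / 2"
    using \<alpha>(1) by (auto simp: \<delta>_def)
  define m where "m = m\<^sub>0 \<delta>"
  obtain A where A: "is_learner X A" "agnostically_learns X F \<epsilon> \<delta> m A"
    using m\<^sub>0[OF \<delta>(1,2)] unfolding m_def by blast
  \<comment> \<open>The sample size is already fixed, so the sequence may be chosen longer than
    m/\<alpha>. The strict inequality also makes it nonempty when \<open>m\<close> is 0.\<close>
  obtain s where s: "s \<in> lists (X \<times> {0..1})" "fat_shatters F (\<epsilon> + \<alpha>) s"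
      "length s > nat \<lceil>m / \<alpha>\<rceil>"
    using fat_infinite_long[OF \<alpha>(2)] by blast
  have ne: "s \<noteq> []"
    using s(3) by auto
  have "m / \<alpha> \<le> length s"
    using s(3) by linarith
  then have "real m / (2 * length s) \<le> \<alpha> / 2"
    using ne \<alpha>(1) by (simp add: field_simps)
  then have "\<epsilon> + \<delta> \<le> \<epsilon> + \<alpha> - real m / (2 * length s)"
    using \<delta>(3) by linarith
  then have "\<not> agnostically_learns X F \<epsilon> \<delta> m A"
    using assms(1,2) \<alpha>(1) s(1,2) ne A(1)
    by (intro fat_shatters_not_learns[where \<gamma> = "\<epsilon> + \<alpha>" and s = s]) auto
  then show False
    using A(2) by contradiction
qed

end
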